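(* Let $\Phi$ be a field of characteristic different from $2,3,5$, and let $U=U_{11}^{+}\oplus U_{11}^{-}\oplus U_{13}^{+}\oplus U_{13}^{-}$ be a vector space over $\Phi$ presented as a direct sum of four subspaces; put $U_{11}=U_{11}^+\oplus U_{11}^-$, $U_{13}=U_{13}^+\oplus U_{13}^-$. Let $L=\mathrm{id}_U$, and let $R,Q$ be the linear operators with $Rx=x$ on $U_{11}$, $Rx=3x$ on $U_{13}$, $Qx=\pm x$ on $U_{11}^{\pm}$, $Qx=\pm3x$ on $U_{13}^{\pm}$. Consider the system (S1)–(S14) of the context for three unknown bilinear maps $E_1,E_2,E_3:U\times U\to U$ (representing $(exy)$, $(xey)$, $(xye)$ respectively), and write $x\circ y=E_2(x,y)$. Direct part. For every solution of (S1)–(S14) one has $x\circ y=A_1(x,y)+A_3(x,y)$ with $A_1(x,y)\in U_{11}$, $A_3(x,y)\in U_{13}$ for all $x,y$, where (a) $A_1(x,y)=A_1(y,x)$ for all $x,y\in U$; (b) $(-3)^{p(y)}A_3(x,y)=-(-3)^{p(x)}A_3(y,x)$ for $x,y\in U_{11}\cup U_{13}$, with $p=0$ on $U_{11}$ and $p=1$ on $U_{13}$; i.e. $A_3(x,y)=-A_3(y,x)$ for $x,y\in U_{11}$ and for $x,y\in U_{13}$, and $A_3(x,y)=3A_3(y,x)$ for $x\in U_{13},\,y\in U_{11}$; (c) the linear map $x\mapsto\tilde x$, equal to $+1$ on $U_{+}=U_{11}^{+}\oplus U_{13}^{-}$ and $-1$ on $U_{-}=U_{11}^{-}\oplus U_{13}^{+}$,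 is an involutive automorphism of $\circ$: $\widetilde{x\circ y}=\tilde x\circ\tilde y$ for all $x,y$; hence $U_+\circ U_+\subset U_+$, $U_-\circ U_-\subset U_+$, $U_-\circ U_+\subset U_-$, $U_+\circ U_-\subset U_-$; (d) $E_1,E_3$ are given by $$E_1(x,y)=\bar x\circ y,\qquad E_3(x,y)=R(Q^{-1}(y)\circ x)+x\circ\bar y-Q^{-1}(y)\circ Rx,$$ where $\bar x=RQ^{-1}x$ (so $\bar x=x$ on $U_{11}^+\oplus U_{13}^+$ and $\bar x=-x$ on $U_{11}^-\oplus U_{13}^-$). Converse part. Any bilinear operation $x\circ y=A_1(x,y)+A_3(x,y)$ on $U$ with $A_1(x,y)\in U_{11}$, $A_3(x,y)\in U_{13}$ such that $\sim$ is an involutive automorphism of $\circ$ and $A_1,A_3$ satisfy (a) and (b) defines a solution of (S1)–(S14) by $E_2(x,y)=x\circ y$ and the formulas (d).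
   Context: The system, to hold for all values of the variables in $U$ ($1$ denotes the identity operator when added to operators): (S1) $L E_2(y,z)=E_2(Ly,z)-E_2(y,z)+E_2(y,Lz)$; (S2) $L E_3(y,v)=E_3(Ly,v)-E_3(y,Lv)+E_3(y,v)$; (S3) $L E_1(v,z)=E_1(v,z)-E_1(Lv,z)+E_1(v,Lz)$; (S4) $E_3(x,u)=R E_3(x,u)-Q E_3(u,x)+L E_3(x,u)$; (S5) $E_2(x,Qv)=E_3(Rx,v)-Q E_1(x,v)+E_1(v,Rx)$; (S6) $E_2(x,Ry)=R E_2(x,y)-E_3(y,Qx)+E_2(y,Rx)$; (S7) $E_2(x,Lz)=E_2(Rx,z)-E_1(Qx,z)+L E_2(x,z)$; (S8) $E_1(u,Ry)=R E_1(u,y)-E_3(y,Ru)+E_2(y,Qu)$; (S9) $E_1(u,Qv)=E_3(Qu,v)-Q E_2(u,v)+E_1(v,Qu)$; (S10) $E_1(u,Lz)=E_2(Qu,z)-E_1(Ru,z)+L E_1(u,z)$; (S11) $(R-2L-1)(E_2(a,b)-E_2(b,a))=0$; (S12) $E_3((R-2L-1)a,u)-E_1(u,(R-2L-1)a)=0$; (S13) $(R-L)(E_3(a,v)-E_1(v,a))+E_1(Rv,a)-E_3(a,Rv)=E_1(v,(R-L)a)$; (S14) $E_2((R-L)a,c)-2E_2(c,(R-L)a)=E_3(a,Qc)-E_1(Qc,a)$. *)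

theory Defs
  imports "HOL.Vector_Spaces" "HOL-Library.Set_Algebras"
begin

definition internal_direct_sum4 ::
  "('k::field \<Rightarrow> 'u::ab_group_add \<Rightarrow> 'u) \<Rightarrow> 'u set \<Rightarrow> 'u set \<Rightarrow> 'u set \<Rightarrow> 'u set \<Rightarrow> bool"
  where "internal_direct_sum4 scale A B C D \<longleftrightarrow>
    module.subspace scale A \<and> module.subspace scale B \<and>
    module.subspace scale C \<and> module.subspace scale D \<and>
    bij_betw (\<lambda>(a, b, c, d). a + b + c + d) (A \<times> B \<times> C \<times> D) UNIV"

definition bilinear_map ::
  "('k::field \<Rightarrow> 'u::ab_group_add \<Rightarrow> 'u) \<Rightarrow> ('u \<Rightarrow> 'u \<Rightarrow> 'u) \<Rightarrow> bool"
  where "bilinear_map scale B \<longleftrightarrow>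
    (\<forall>x. Vector_Spaces.linear scale scale (B x)) \<and>
    (\<forall>y. Vector_Spaces.linear scale scale (\<lambda>x. B x y))"

definition involutive_automorphism ::
  "('k::field \<Rightarrow> 'u::ab_group_add \<Rightarrow> 'u) \<Rightarrow> ('u \<Rightarrow> 'u \<Rightarrow> 'u) \<Rightarrow> ('u \<Rightarrow> 'u) \<Rightarrow> bool"
  where "involutive_automorphism scale f T \<longleftrightarrow>
    Vector_Spaces.linear scale scale T \<and> bij T \<and>
    (\<forall>x. T (T x) = x) \<and> (\<forall>x y. T (f x y) = f (T x) (T y))"

text \<open>The unknowns \<open>E1 x y\<close>, \<open>E2 x y\<close>, \<open>E3 x y\<close> stand for the products
  \<open>(exy)\<close>, \<open>(xey)\<close>, \<open>(xye)\<close>; \<open>N\<close> is the operator \<open>R - 2L - 1\<close> and \<open>M\<close> is \<open>R - L\<close>.\<close>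

definition solves_system ::
  "('k::field \<Rightarrow> 'u::ab_group_add \<Rightarrow> 'u) \<Rightarrow> ('u \<Rightarrow> 'u) \<Rightarrow> ('u \<Rightarrow> 'u) \<Rightarrow> ('u \<Rightarrow> 'u) \<Rightarrow>
   ('u \<Rightarrow> 'u \<Rightarrow> 'u) \<Rightarrow> ('u \<Rightarrow> 'u \<Rightarrow> 'u) \<Rightarrow> ('u \<Rightarrow> 'u \<Rightarrow> 'u) \<Rightarrow> bool"
  where "solves_system scale L R Q E1 E2 E3 \<longleftrightarrow>
    (let N = (\<lambda>x. R x - scale 2 (L x) - x); M = (\<lambda>x. R x - L x) in
    (\<forall>y z. L (E2 y z) = E2 (L y) z - E2 y z + E2 y (L z)) \<and>
    (\<forall>y v. L (E3 y v) = E3 (L y) v - E3 y (L v) + E3 y v) \<and>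
    (\<forall>v z. L (E1 v z) = E1 v z - E1 (L v) z + E1 v (L z)) \<and>
    (\<forall>x u. E3 x u = R (E3 x u) - Q (E3 u x) + L (E3 x u)) \<and>
    (\<forall>x v. E2 x (Q v) = E3 (R x) v - Q (E1 x v) + E1 v (R x)) \<and>
    (\<forall>x y. E2 x (R y) = R (E2 x y) - E3 y (Q x) + E2 y (R x)) \<and>
    (\<forall>x z. E2 x (L z) = E2 (R x) z - E1 (Q x) z + L (E2 x z)) \<and>
    (\<forall>u y. E1 u (R y) = R (E1 u y) - E3 y (R u) + E2 y (Q u)) \<and>
    (\<forall>u v. E1 u (Q v) = E3 (Q u) v - Q (E2 u v) + E1 v (Q u)) \<and>
    (\<forall>u z. E1 u (L z) = E2 (Q u) z - E1 (R u) z + L (E1 u z)) \<and>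
    (\<forall>a b. N (E2 a b - E2 b a) = 0) \<and>
    (\<forall>a u. E3 (N a) u - E1 u (N a) = 0) \<and>
    (\<forall>a v. M (E3 a v - E1 v a) + E1 (R v) a - E3 a (R v) = E1 v (M a)) \<and>
    (\<forall>a c. E2 (M a) c - scale 2 (E2 c (M a)) = E3 a (Q c) - E1 (Q c) a))"

text \<open>Meant for arguments in \<open>U11 \<union> U13\<close> only. The vector 0 lies in both subspaces and gets
  the value 0, which is harmless: for a bilinear operation the identity in \<open>parity_skew\<close> reads \<open>0 = 0\<close>
  when one of its arguments is 0.\<close>

definition parity :: "'u set \<Rightarrow> 'u \<Rightarrow> nat"
  where "parity U11 x = (if x \<in> U11 then 0 else 1)"

definition commutative_op :: "('u \<Rightarrow> 'u \<Rightarrow> 'u) \<Rightarrow> bool"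
  where "commutative_op A1 \<longleftrightarrow> (\<forall>x y. A1 x y = A1 y x)"

definition parity_skew ::
  "('k::field \<Rightarrow> 'u::ab_group_add \<Rightarrow> 'u) \<Rightarrow> 'u set \<Rightarrow> 'u set \<Rightarrow> ('u \<Rightarrow> 'u \<Rightarrow> 'u) \<Rightarrow> bool"
  where "parity_skew scale U11 U13 A3 \<longleftrightarrow>
    (\<forall>x \<in> U11 \<union> U13. \<forall>y \<in> U11 \<union> U13.
      scale ((-3) ^ parity U11 y) (A3 x y) = - scale ((-3) ^ parity U11 x) (A3 y x))"

definition bar :: "('u \<Rightarrow> 'u) \<Rightarrow> ('u \<Rightarrow> 'u) \<Rightarrow> 'u \<Rightarrow> 'u"
  where "bar R Q x = R (inv Q x)"

definition first_op :: "('u \<Rightarrow> 'u) \<Rightarrow> ('u \<Rightarrow> 'u) \<Rightarrow> ('u \<Rightarrow> 'u \<Rightarrow> 'u) \<Rightarrow> 'u \<Rightarrow> 'u \<Rightarrow> 'u"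
  where "first_op R Q f x y = f (bar R Q x) y"

definition third_op ::
  "('u::ab_group_add \<Rightarrow> 'u) \<Rightarrow> ('u \<Rightarrow> 'u) \<Rightarrow> ('u \<Rightarrow> 'u \<Rightarrow> 'u) \<Rightarrow> 'u \<Rightarrow> 'u \<Rightarrow> 'u"
  where "third_op R Q f x y = R (f (inv Q y) x) + f x (bar R Q y) - f (inv Q y) (R x)"

end

theory Submission
  imports Defs
begin

text \<open>Every vector is a sum of weight vectors \<open>x\<close>, with \<open>R x = r x\<close> and \<open>Q x = r s x\<close> for \<open>r \<in> {1, 3}\<close>, \<open>s = \<plusminus>1\<close>, so
  that \<open>bar\<close> and \<open>T\<close> act on \<open>x\<close> as \<open>s\<close> and \<open>s (2 - r)\<close>. By (S7), \<open>E1\<close> is determined by \<open>E2\<close>, and by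
  (S6) so is \<open>E3\<close>. On weight vectors \<open>x\<close>, \<open>y\<close>, and after applying a linear functional that is itself an
  eigenvector of \<open>R\<close> and \<open>Q\<close>, the remaining equations become linear equations between the two scalars
  \<open>a\<close> and \<open>b\<close> obtained from \<open>E2 x y\<close> and \<open>E2 y x\<close>. For each of the finitely many weights involved these
  are equivalent to the scalar forms of (a), (b) and (c).\<close>

section \<open>Scalar form of the system on weight vectors\<close>

text \<open>Here \<open>a\<close>, \<open>b\<close>, \<open>c\<close>, \<open>d\<close> stand for
  the values of a functional of weight \<open>(p, w)\<close> on \<open>E2 x y\<close>,
  \<open>E2 y x\<close>, \<open>E3 x y\<close>, \<open>E3 y x\<close>, with \<open>x\<close> of
  weight \<open>(r, s)\<close> and \<open>y\<close> of weight \<open>(t, u)\<close>. The two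
  instances of (S6) eliminate \<open>c\<close> and \<open>d\<close>. Then (S11) gives symmetry for
  \<open>p = 1\<close>, (S14) gives skewness for \<open>p = 3\<close>, and (S5) gives the sign
  rule.\<close>

lemma scalar_relations:
  fixes a b c d :: "'k::field"
  assumes nz: "(2::'k) \<noteq> 0" "(3::'k) \<noteq> 0"
    and r: "r = 1 \<or> r = 3" and t: "t = 1 \<or> t = 3" and p: "p = 1 \<or> p = 3"
    and s: "s * s = 1" and u: "u * u = 1"
    and S5: "t * u * a = r * c - p * w * (s * a) + r * (u * b)"
    and S6: "t * a = p * a - r * s * d + r * b" "r * b = p * b - t * u * c + t * a"
    and S11: "(p - 3) * (a - b) = 0"
    and S14: "(r - 1) * (a - 2 * b) = t * u * (c - u * b)" "(t - 1) * (b - 2 * a) = r * s * (d - s * a)"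
  shows "(p - 1) * ((3 - 2 * t) * a + (3 - 2 * r) * b) = 0"
    and "(w * (2 - p) - s * (2 - r) * (u * (2 - t))) * a = 0" 
proof -
  \<comment> \<open>Since \<open>s\<close> and \<open>u\<close> square to 1, clearing
    \<open>c\<close> and \<open>d\<close> leaves the signs only in this product.\<close>
  define e where "e = s * u * w"
  have S5': "t * t * a = r * ((p - r) * b + t * a) - p * e * t * a + r * t * b"
    using S6(2) S5 u unfolding e_def by algebra
  have S14': "(r - 1) * (a - 2 * b) = (p - r) * b + t * a - t * b"
    "(t - 1) * (b - 2 * a) = (p - t) * a + r * b - r * a"
    using S6 S14 s u by algebra+
  have sym: "a = b" if "p = 1"
  proof -
    have "2 * (a - b) = 0" using S11 that by algebra
    then show ?thesis using nz by simp
  qed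
  have skew: "(3 - 2 * t) * a + (3 - 2 * r) * b = 0" if "p = 3"
    using r t S14' unfolding that by (elim disjE; hypsubst; algebra)
  show "(p - 1) * ((3 - 2 * t) * a + (3 - 2 * r) * b) = 0"
    using skew p by auto
  \<comment> \<open>Depending on the weights, (S5) yields the relation times 1, 3 or 9 up to sign.
    The common multiple 9 serves all cases and is cancelled afterwards.\<close>
  have "3 * 3 * ((e * (2 - p) - (2 - r) * (2 - t)) * a) = 0"
    using p
  proof
    assume p: "p = 1"
    show ?thesis
      using r t S5' sym[OF p] unfolding p by (elim disjE; hypsubst; algebra)
  next
    assume p: "p = 3"
    show ?thesis
      using r t S5' skew[OF p] unfolding p by (elim disjE; hypsubst; algebra)
  qed
  then have "(e * (2 - p) - (2 - r) * (2 - t)) * a = 0"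
    using nz by (simp only: mult_eq_0_iff) simp
  then show "(w * (2 - p) - s * (2 - r) * (u * (2 - t))) * a = 0"
    using s u unfolding e_def by algebra
qed

text \<open>The six conclusions are (S4), (S5), (S9), (S12), (S13), (S14) on weight vectors, in this
  order. Each is multiplied by a nonzero factor (\<open>r * t * u\<close> or \<open>t * u\<close>)
  so that \<open>c\<close> and \<open>d\<close> can be replaced by combinations of \<open>a\<close>
  and \<open>b\<close>; the result is checked weight by weight.\<close>

lemma scalar_relations_converse:
  fixes a b c d :: "'k::field"
  assumes nz: "(2::'k) \<noteq> 0" "(3::'k) \<noteq> 0"
    and r: "r = 1 \<or> r = 3" and t: "t = 1 \<or> t = 3" and p: "p = 1 \<or> p = 3"
    and s: "s * s = 1" and u: "u * u = 1"
    and sym: "(p - 3) * (a - b) = 0"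
    and skew: "(p - 1) * ((3 - 2 * t) * a + (3 - 2 * r) * b) = 0"
    and sign: "(w * (2 - p) - s * (2 - r) * (u * (2 - t))) * a = 0"
    and c: "t * u * c = (p - r) * b + t * a" and d: "r * s * d = (p - t) * a + r * b"
  shows "p * c = p * w * d"
    and "t * u * a = r * c - p * w * (s * a) + r * (u * b)"
    and "t * u * (s * a) = r * s * c - p * w * a + r * s * (u * b)"
    and "(r - 3) * (c - u * b) = 0"
    and "(p - 1) * (c - u * b) + t * u * b - t * c = (r - 1) * (u * b)"
    and "(r - 1) * (a - 2 * b) = t * u * (c - u * b)"
proof -
  define e where "e = s * u * w"
  have nz': "r \<noteq> 0" "t \<noteq> 0" "s \<noteq> 0" "u \<noteq> 0"
    using r t nz s u by auto
  have e: "(e * (2 - p) - (2 - r) * (2 - t)) * a = 0"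
    using sign s u unfolding e_def by algebra
  have sym': "a = b" if "p = 1"
  proof -
    have "2 * (a - b) = 0" using sym that by algebra
    then show ?thesis using nz by simp
  qed
  have skew': "r = 1 \<and> t = 1 \<and> a = - b \<or> r = 1 \<and> t = 3 \<and> b = 3 * a \<or>
    r = 3 \<and> t = 1 \<and> a = 3 * b \<or> r = 3 \<and> t = 3 \<and> a = - b" if "p = 3"
  proof -
    have "2 * ((3 - 2 * t) * a + (3 - 2 * r) * b) = 0" using skew that by algebra
    then have *: "(3 - 2 * t) * a + (3 - 2 * r) * b = 0"
      using nz by (simp only: mult_eq_0_iff) simp
    \<comment> \<open>For two arguments of weight 3 the relation reads
      \<open>-3 * (a + b) = 0\<close>, so 3 has to be cancelled.\<close>
    then have "3 * (a + b) = 0" if "r = 3" "t = 3" using that by algebra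
    then have "a + b = 0" if "r = 3" "t = 3"
      using nz that by (simp only: mult_eq_0_iff) simp
    then show ?thesis
      using r t * by (elim disjE) (simp_all add: eq_neg_iff_add_eq_0 algebra_simps)
  qed
  have E4: "r * ((p - r) * b + t * a) = e * t * ((p - t) * a + r * b)"
    using p
  proof
    assume p: "p = 1"
    show ?thesis
      using r t e sym'[OF p] unfolding p by (elim disjE; hypsubst; algebra)
  next
    assume p: "p = 3"
    show ?thesis
      using e skew'[OF p] unfolding p by (elim disjE conjE; hypsubst; algebra)
  qed
  have E5: "t * t * a = r * ((p - r) * b + t * a) - p * e * t * a + r * t * b"
    using p
  proof
    assume p: "p = 1"
    show ?thesis
      using r t e sym'[OF p] unfolding p by (elim disjE; hypsubst; algebra)
  next
    assume p: "p = 3"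
    show ?thesis
      using e skew'[OF p] unfolding p by (elim disjE conjE; hypsubst; algebra)
  qed
  have E12: "(r - 3) * ((p - r) * b + t * a - t * b) = 0"
    using p
  proof
    assume p: "p = 1"
    show ?thesis
      using r t sym'[OF p] unfolding p by (elim disjE) (simp_all add: algebra_simps)
  next
    assume p: "p = 3"
    show ?thesis
      using skew'[OF p] unfolding p by (elim disjE) (simp_all add: algebra_simps)
  qed
  have E14: "(r - 1) * (a - 2 * b) = (p - r) * b + t * a - t * b"
    using p
  proof
    assume p: "p = 1"
    show ?thesis
      using r t sym'[OF p] unfolding p by (elim disjE) (simp_all add: algebra_simps)
  next
    assume p: "p = 3"
    show ?thesis
      using skew'[OF p] unfolding p by (elim disjE) (simp_all add: algebra_simps)
  qed
  have E13: "(p - 1) * ((p - r) * b + t * a - t * b) + t * (t * b) - t * ((p - r) * b + t * a) = t * (r - 1) * b"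
    using p
  proof
    assume p: "p = 1"
    show ?thesis
      using r t sym'[OF p] unfolding p by (elim disjE) (simp_all add: algebra_simps)
  next
    assume p: "p = 3"
    show ?thesis
      using skew'[OF p] unfolding p by (elim disjE) (simp_all add: algebra_simps)
  qed
  \<comment> \<open>This is \<open>c = w * d\<close> multiplied by \<open>r * t * u\<close>, because
    \<open>e * s = u * w\<close>.\<close>
  have "r * (t * u * c) = e * t * (r * s * d)"
    unfolding c d by (rule E4)
  then have "r * t * u * (p * c) = r * t * u * (p * w * d)"
    using s unfolding e_def by algebra
  then show "p * c = p * w * d"
    using nz' by simp
  have "t * t * a = r * (t * u * c) - p * e * t * a + r * t * b"
    unfolding c by (rule E5)
  then have "t * u * (t * u * a) = t * u * (r * c - p * w * (s * a) + r * (u * b))"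
    using u unfolding e_def by algebra
  then show S5: "t * u * a = r * c - p * w * (s * a) + r * (u * b)"
    using nz' by simp
  show "t * u * (s * a) = r * s * c - p * w * a + r * s * (u * b)"
    using S5 s by algebra
  have tuc: "(p - r) * b + t * a - t * b = t * u * (c - u * b)"
    using c u by algebra
  have "t * u * ((r - 3) * (c - u * b)) = 0"
    using E12 unfolding tuc by (simp add: ac_simps)
  then show "(r - 3) * (c - u * b) = 0"
    using nz' by simp
  have "(p - 1) * (t * u * (c - u * b)) + t * (t * b) - t * (t * u * c) = t * (r - 1) * b"
    using E13 unfolding tuc unfolding c .
  then have "t * u * ((p - 1) * (c - u * b) + t * u * b - t * c) = t * u * ((r - 1) * (u * b))"
    using u by algebra
  then show "(p - 1) * (c - u * b) + t * u * b - t * c = (r - 1) * (u * b)"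
    using nz' by simp
  show "(r - 1) * (a - 2 * b) = t * u * (c - u * b)"
    using E14 unfolding tuc .
qed

lemma linearD:
  assumes "Vector_Spaces.linear scale scale' f"
  shows "f (x + y) = f x + f y" "f (scale c x) = scale' c (f x)"
    "f (x - y) = f x - f y" "f (- x) = - f x" "f 0 = 0"
proof -
  interpret Vector_Spaces.linear scale scale' f by (fact assms)
  show "f (x + y) = f x + f y" "f (scale c x) = scale' c (f x)"
    "f (x - y) = f x - f y" "f (- x) = - f x" "f 0 = 0"
    by (fact add scale diff neg zero)+
qed

lemma bilinear_mapD:
  assumes "bilinear_map scale E"
  shows "E (x + y) z = E x z + E y z" "E x (y + z) = E x y + E x z"
    "E (scale c x) y = scale c (E x y)" "E x (scale c y) = scale c (E x y)"
    "E (x - y) z = E x z - E y z" "E x (y - z) = E x y - E x z"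
    "E (- x) y = - E x y" "E x (- y) = - E x y"
proof -
  have "Vector_Spaces.linear scale scale (E x)" for x
    using assms by (simp add: bilinear_map_def)
  note right = linearD[OF this]
  have "Vector_Spaces.linear scale scale (\<lambda>x. E x y)" for y
    using assms by (simp add: bilinear_map_def)
  note left = linearD[OF this]
  show "E (x + y) z = E x z + E y z" "E x (y + z) = E x y + E x z"
    "E (scale c x) y = scale c (E x y)" "E x (scale c y) = scale c (E x y)"
    "E (x - y) z = E x z - E y z" "E x (y - z) = E x y - E x z"
    "E (- x) y = - E x y" "E x (- y) = - E x y"
    by (fact left right)+
qed

section \<open>Weight vectors\<close>

definition weight_vector ::
  "('k::field \<Rightarrow> 'u::ab_group_add \<Rightarrow> 'u) \<Rightarrow> ('u \<Rightarrow> 'u) \<Rightarrow> ('u \<Rightarrow> 'u) \<Rightarrow> 'k \<Rightarrow> 'k \<Rightarrow> 'u \<Rightarrow> bool"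
  where "weight_vector scale R Q r s x \<longleftrightarrow>
    (r = 1 \<or> r = 3) \<and> (s = 1 \<or> s = -1) \<and> R x = scale r x \<and> Q x = scale (r * s) x"

text \<open>The defining property of \<open>T\<close>, that it acts on weight vectors as \<open>s (2 - r)\<close>, is expressed by the
  operator identity \<open>three_T\<close>: \<open>r s (5 - 2 r) = 3 s (2 - r)\<close> for both values of \<open>r\<close>.\<close>

locale weight_space = vector_space scale
  for scale :: "'k::field \<Rightarrow> 'u::ab_group_add \<Rightarrow> 'u" (infixr "*s" 75) +
  fixes R Q T :: "'u \<Rightarrow> 'u"
  assumes two_nz: "(2::'k) \<noteq> 0" and three_nz: "(3::'k) \<noteq> 0"
    and linear_R: "Vector_Spaces.linear scale scale R"
    and linear_Q: "Vector_Spaces.linear scale scale Q"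
    and linear_T: "Vector_Spaces.linear scale scale T"
    and three_T: "3 *s T x = Q (5 *s x - 2 *s R x)"
    and weight_decomposition: "\<exists>a b c d. x = a + b + c + d \<and> weight_vector scale R Q 1 1 a \<and>
      weight_vector scale R Q 1 (-1) b \<and> weight_vector scale R Q 3 1 c \<and> weight_vector scale R Q 3 (-1) d"
begin

abbreviation wt :: "'k \<Rightarrow> 'k \<Rightarrow> 'u \<Rightarrow> bool"
  where "wt \<equiv> weight_vector scale R Q"

lemmas R_simps = linearD[OF linear_R]
lemmas Q_simps = linearD[OF linear_Q]
lemmas T_simps = linearD[OF linear_T]

lemma weight_induct [case_names weight add]:
  assumes "\<And>r s x. wt r s x \<Longrightarrow> P x" and "\<And>x y. P x \<Longrightarrow> P y \<Longrightarrow> P (x + y)"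
  shows "P x"
proof -
  obtain a b c d where "x = a + b + c + d" "wt 1 1 a" "wt 1 (-1) b" "wt 3 1 c" "wt 3 (-1) d"
    using weight_decomposition by blast
  with assms show ?thesis by metis
qed

lemma wtD:
  assumes "wt r s x"
  shows "r = 1 \<or> r = 3" "s = 1 \<or> s = -1" "s * s = 1" "r \<noteq> 0"
    "R x = r *s x" "Q x = (r * s) *s x" "T x = (s * (2 - r)) *s x"
proof -
  show "r = 1 \<or> r = 3" "s = 1 \<or> s = -1" "s * s = 1" "r \<noteq> 0"
    and R: "R x = r *s x" and Q: "Q x = (r * s) *s x"
    using assms three_nz by (auto simp: weight_vector_def)
  have "r * s * (5 - 2 * r) = 3 * (s * (2 - r))"
    using assms by (auto simp: weight_vector_def)
  moreover have "3 *s T x = (r * s * (5 - 2 * r)) *s x"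
    by (simp add: three_T R Q Q_simps algebra_simps)
  ultimately have "3 *s T x = 3 *s (s * (2 - r)) *s x"
    by simp
  then show "T x = (s * (2 - r)) *s x"
    using three_nz by (simp only: scale_cancel_left) simp
qed

section \<open>Functionals of a given weight\<close>

text \<open>An eigenvector of the transposes of \<open>R\<close> and \<open>Q\<close>. Testing the
  values of a product with such functionals replaces splitting them into weight components.\<close>

definition wt_functional :: "'k \<Rightarrow> 'k \<Rightarrow> ('u \<Rightarrow> 'k) \<Rightarrow> bool"
  where "wt_functional p w \<phi> \<longleftrightarrow> (p = 1 \<or> p = 3) \<and> (w = 1 \<or> w = -1) \<and>
    Vector_Spaces.linear scale (*) \<phi> \<and> (\<forall>z. \<phi> (R z) = p * \<phi> z) \<and> (\<forall>z. \<phi> (Q z) = p * w * \<phi> z)"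

text \<open>A nonzero vector forms an independent set, so a functional with value 1 on it extends to
  the whole space, in any dimension.\<close>

lemma exists_functional_nonzero:
  assumes "v \<noteq> 0"
  obtains \<psi> where "Vector_Spaces.linear scale ((*) :: 'k \<Rightarrow> 'k \<Rightarrow> 'k) \<psi>" "\<psi> v \<noteq> 0"
proof -
  interpret K: vector_space "(*) :: 'k \<Rightarrow> 'k \<Rightarrow> 'k"
    by unfold_locales (simp_all add: algebra_simps)
  interpret VK: vector_space_pair scale "(*) :: 'k \<Rightarrow> 'k \<Rightarrow> 'k" ..
  have "independent {v}"
    using assms by simp
  then obtain \<psi> where "Vector_Spaces.linear scale ((*) :: 'k \<Rightarrow> 'k \<Rightarrow> 'k) \<psi>" "\<forall>x\<in>{v}. \<psi> x = 1"
    using VK.linear_independent_extend[of "{v}" "\<lambda>_. 1"] by blast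
  then show thesis
    using that by simp
qed

text \<open>Since \<open>R\<close> only has the eigenvalues 1 and 3, the operator \<open>(R - (4 - p)) (Q + p w)\<close> is a nonzero
  multiple of the projection onto the weight space \<open>(p, w)\<close>.\<close>

definition weight_part :: "'k \<Rightarrow> 'k \<Rightarrow> 'u \<Rightarrow> 'u"
  where "weight_part p w z = (let y = Q z + (p * w) *s z in R y - (4 - p) *s y)"

lemma weight_part_add: "weight_part p w (x + y) = weight_part p w x + weight_part p w y"
  by (simp add: weight_part_def Let_def R_simps Q_simps algebra_simps)

lemma weight_part_scale: "weight_part p w (c *s x) = c *s weight_part p w x"
  by (simp add: weight_part_def Let_def R_simps Q_simps algebra_simps)

text \<open>For \<open>p\<close> in {1, 3} and \<open>w = 1\<close> or \<open>w = -1\<close>, the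
  factor \<open>r + p - 4\<close> vanishes exactly when \<open>r\<close> differs from
  \<open>p\<close>; if \<open>r = p\<close>, the other factor is \<open>p * (s + w)\<close>, which
  vanishes exactly when \<open>s\<close> differs from \<open>w\<close>.\<close>

lemma weight_part_weight:
  assumes "wt r s x"
  shows "weight_part p w x = ((r + p - 4) * (r * s + p * w)) *s x"
  by (simp add: weight_part_def Let_def R_simps Q_simps wtD[OF assms] algebra_simps)

text \<open>On a weight vector either the coefficient of \<open>weight_part p w\<close> is zero or
  the weight is \<open>(p, w)\<close>. Hence precomposing with \<open>R\<close> or \<open>Q\<close>
  multiplies \<open>weight_part p w\<close>, and any functional after it, by \<open>p\<close> or
  \<open>p * w\<close>.\<close>

lemma wt_functional_weight_part:
  assumes \<psi>: "Vector_Spaces.linear scale (*) \<psi>" and p: "p = 1 \<or> p = 3" and w: "w = 1 \<or> w = -1"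
  shows "wt_functional p w (\<lambda>z. \<psi> (weight_part p w z))"
proof -
  have R: "weight_part p w (R z) = p *s weight_part p w z" for z
  proof (induction z rule: weight_induct)
    case (weight r s x)
    have "(r + p - 4) * (r * s + p * w) * r = p * ((r + p - 4) * (r * s + p * w))"
      using wtD(1)[OF weight] p by (elim disjE) simp_all
    then show ?case
      by (simp add: weight_part_weight[OF weight] wtD[OF weight] weight_part_scale mult_ac)
  qed (simp add: R_simps weight_part_add scale_right_distrib)
  have Q: "weight_part p w (Q z) = (p * w) *s weight_part p w z" for z
  proof (induction z rule: weight_induct)
    case (weight r s x)
    have "(r + p - 4) * (r * s + p * w) * (r * s) = p * w * ((r + p - 4) * (r * s + p * w))"
      using wtD(1,2)[OF weight] p w by (elim disjE) simp_all
    then show ?case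
      by (simp add: weight_part_weight[OF weight] wtD[OF weight] weight_part_scale mult_ac)
  qed (simp add: Q_simps weight_part_add scale_right_distrib)
  show ?thesis
    using \<psi> p w unfolding wt_functional_def Vector_Spaces.linear_iff
    by (simp add: R Q weight_part_add weight_part_scale)
qed

text \<open>If some \<open>weight_part p w v\<close> were nonzero, a functional not vanishing on it
  would give a weight functional not vanishing on \<open>v\<close>. So all four parts vanish, and
  these are nonzero multiples of the weight components.\<close>

lemma zero_if_functionals_zero:
  assumes "\<And>p w \<phi>. wt_functional p w \<phi> \<Longrightarrow> \<phi> v = 0"
  shows "v = 0"
proof -
  have part: "weight_part p w v = 0" if "p = 1 \<or> p = 3" "w = 1 \<or> w = -1" for p w
    using assms[OF wt_functional_weight_part[OF _ that]] exists_functional_nonzero by metis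
  obtain a b c d where v: "v = a + b + c + d" and
    wts: "wt 1 1 a" "wt 1 (-1) b" "wt 3 1 c" "wt 3 (-1) d"
    using weight_decomposition by blast
  note [simp] = weight_part_add wts[THEN weight_part_weight]
  \<comment> \<open>On its own weight space \<open>weight_part p w\<close> is multiplication by 4
    (for \<open>p = 1\<close>) or 12 (for \<open>p = 3\<close>), up to sign.\<close>
  have nz: "(2::'k) * 2 \<noteq> 0" "(2::'k) * 2 * 3 \<noteq> 0"
    using two_nz three_nz by (auto simp only: mult_eq_0_iff)
  have "a = 0"
    using part[of 1 1] nz unfolding v by simp
  moreover have "b = 0"
    using part[of 1 "-1"] nz unfolding v by simp
  moreover have "c = 0"
    using part[of 3 1] nz unfolding v by simp
  moreover have "d = 0"
    using part[of 3 "-1"] nz unfolding v by simp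
  ultimately show ?thesis
    by (simp add: v)
qed

lemma wt_functionalD:
  assumes "wt_functional p w \<phi>"
  shows "p = 1 \<or> p = 3" "w = 1 \<or> w = -1"
    "\<phi> (x + y) = \<phi> x + \<phi> y" "\<phi> (c *s x) = c * \<phi> x" "\<phi> (x - y) = \<phi> x - \<phi> y" "\<phi> (- x) = - \<phi> x" "\<phi> 0 = 0"
    "\<phi> (R x) = p * \<phi> x" "\<phi> (Q x) = p * w * \<phi> x"
proof -
  have \<phi>: "Vector_Spaces.linear scale (*) \<phi>"
    using assms by (simp add: wt_functional_def)
  show "\<phi> (x + y) = \<phi> x + \<phi> y" "\<phi> (c *s x) = c * \<phi> x" "\<phi> (x - y) = \<phi> x - \<phi> y" "\<phi> (- x) = - \<phi> x" "\<phi> 0 = 0"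
    by (fact linearD[OF \<phi>])+
qed (use assms in \<open>auto simp: wt_functional_def\<close>)

text \<open>A functional of weight \<open>(p, w)\<close> vanishes on weight vectors of any other
  weight, and on those of weight \<open>(p, w)\<close> the map \<open>T\<close> acts as
  \<open>w * (2 - p)\<close>.\<close>

lemma wt_functional_T:
  assumes \<phi>: "wt_functional p w \<phi>"
  shows "\<phi> (T x) = w * (2 - p) * \<phi> x"
proof (induction x rule: weight_induct)
  case (weight r s x)
  have "r * \<phi> x = p * \<phi> x" "r * s * \<phi> x = p * w * \<phi> x"
    using wt_functionalD(8,9)[OF \<phi>, of x] by (simp_all add: wtD[OF weight] wt_functionalD[OF \<phi>])
  then have "\<phi> x = 0 \<or> r = p \<and> s = w"
    using wtD(4)[OF weight] by auto
  then show ?case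
    by (auto simp: wtD(7)[OF weight] wt_functionalD[OF \<phi>])
qed (simp add: T_simps wt_functionalD[OF \<phi>] algebra_simps)

section \<open>Reduction of identities to weights\<close>

lemma biadditive_zeroI:
  assumes addl: "\<And>x y z. F (x + y) z = F x z + F y z" and addr: "\<And>x y z. F x (y + z) = F x y + F x z"
    and wts: "\<And>r s x t u y. wt r s x \<Longrightarrow> wt t u y \<Longrightarrow> F x y = 0"
  shows "F x y = (0::'u)"
proof (induction x arbitrary: y rule: weight_induct)
  case (weight r s x)
  then show ?case
  proof (induction y rule: weight_induct)
    case (weight t u y)
    then show ?case using wts by blast
  qed (simp add: addr)
qed (simp add: addl)

text \<open>Arguments decompose into weight vectors and weight functionals separate values, so each
  equation of the system reduces to scalar equations indexed by finitely many weights.\<close>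

lemma biadditive_eqI:
  assumes F: "\<And>x y z. F (x + y) z = F x z + F y z" "\<And>x y z. F x (y + z) = F x y + F x z"
    and G: "\<And>x y z. G (x + y) z = G x z + G y z" "\<And>x y z. G x (y + z) = G x y + G x z"
    and wts: "\<And>r s x t u y p w \<phi>. wt r s x \<Longrightarrow> wt t u y \<Longrightarrow> wt_functional p w \<phi> \<Longrightarrow> \<phi> (F x y) = \<phi> (G x y)"
  shows "\<forall>x y. F x y = (G x y :: 'u)"
proof -
  have "F x y - G x y = 0" for x y
  proof (rule biadditive_zeroI[where F = "\<lambda>x y. F x y - G x y"])
    fix r s x t u y
    assume "wt r s x" "wt t u y"
    then show "F x y - G x y = 0"
      by (intro zero_if_functionals_zero) (simp add: wt_functionalD wts)
  qed (simp_all add: F G)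
  then show ?thesis by simp
qed

section \<open>The inverse of \<open>Q\<close> and the map \<open>bar\<close>\<close>

text \<open>Weight functionals satisfy \<open>\<phi> (Q z) = p * w * \<phi> z\<close> with
  \<open>p * w\<close> nonzero, so the kernel is trivial; preimages of weight vectors are explicit,
  since \<open>s / r\<close> is the inverse of \<open>r * s\<close>.\<close>

lemma bij_Q: "bij Q"
proof (rule bijI)
  show "inj Q"
  proof (rule injI)
    fix x y assume "Q x = Q y"
    then have "Q (x - y) = 0" by (simp add: Q_simps)
    have "\<phi> (x - y) = 0" if \<phi>: "wt_functional p w \<phi>" for p w \<phi>
    proof -
      have "p * w \<noteq> 0" using wt_functionalD(1,2)[OF \<phi>] three_nz by auto
      then show ?thesis
        using wt_functionalD(9)[OF \<phi>, of "x - y"] \<open>Q (x - y) = 0\<close> wt_functionalD(7)[OF \<phi>] by simp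
    qed
    then have "x - y = 0" by (rule zero_if_functionals_zero)
    then show "x = y" by simp
  qed
  have "\<exists>y. Q y = x" for x
  proof (induction x rule: weight_induct)
    case (weight r s x)
    then have "Q ((s / r) *s x) = x"
      using wtD(3,4)[OF weight] by (simp add: Q_simps wtD(6)[OF weight])
    then show ?case by blast
  next
    case (add x y)
    then show ?case using Q_simps(1) by metis
  qed
  then show "surj Q" by (metis surjI)
qed

lemma inv_Q_weight:
  assumes "wt r s x"
  shows "inv Q x = (s / r) *s x"
proof (rule inv_f_eq)
  show "inj Q" using bij_Q by (rule bij_is_inj)
  show "Q ((s / r) *s x) = x"
    using wtD(3,4)[OF assms] by (simp add: Q_simps wtD(6)[OF assms])
qed

lemma inv_Q_Q [simp]: "inv Q (Q x) = x" and Q_inv_Q [simp]: "Q (inv Q x) = x"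
  by (rule inv_f_f[OF bij_is_inj[OF bij_Q]], rule surj_f_inv_f[OF bij_is_surj[OF bij_Q]])

lemma linear_inv_Q: "Vector_Spaces.linear scale scale (inv Q)"
proof -
  have "inv Q (x + y) = inv Q x + inv Q y" for x y
    using inv_Q_Q[of "inv Q x + inv Q y"] by (simp add: Q_simps)
  moreover have "inv Q (c *s x) = c *s inv Q x" for c x
    using inv_Q_Q[of "c *s inv Q x"] by (simp add: Q_simps)
  ultimately show ?thesis
    unfolding Vector_Spaces.linear_iff using vector_space_axioms by blast
qed

lemma bar_weight:
  assumes "wt r s x"
  shows "bar R Q x = s *s x"
  using wtD(4)[OF assms] unfolding bar_def inv_Q_weight[OF assms] R_simps(2) wtD(5)[OF assms] by simp

text \<open>These identities encode (a)--(c): \<open>A1\<close> is the component of \<open>f\<close> on which \<open>R = 1\<close>, \<open>A3\<close> the one on which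
  \<open>R = 3\<close>, and \<open>3 - 2 R\<close> acts on \<open>U11\<close> and \<open>U13\<close> as 1 and -3.\<close>

definition graded_product :: "('u \<Rightarrow> 'u \<Rightarrow> 'u) \<Rightarrow> bool"
  where "graded_product f \<longleftrightarrow>
    (\<forall>x y. R (f x y - f y x) = 3 *s (f x y - f y x)) \<and>
    (\<forall>x y. R (f x (3 *s y - 2 *s R y) + f y (3 *s x - 2 *s R x)) =
      f x (3 *s y - 2 *s R y) + f y (3 *s x - 2 *s R x)) \<and>
    (\<forall>x y. T (f x y) = f (T x) (T y))"

lemma scale_three: "3 *s x = x + 2 *s x"
proof -
  have "3 *s x = (1 + 2) *s x" by simp
  then show ?thesis unfolding scale_left_distrib by simp
qed

section \<open>From solutions to graded products\<close>

text \<open>With \<open>L = id\<close>, (S7) says \<open>E2 (R x) y = E1 (Q x) y\<close>; inverting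
  \<open>Q\<close> here and in (S6) yields the formulas for \<open>E1\<close> and \<open>E3\<close>.
  The graded identities then come from (S5), (S6), (S11) and (S14) through
  \<open>scalar_relations\<close>.\<close>

theorem solution_imp_graded_product:
  assumes E1: "bilinear_map scale E1" and E2: "bilinear_map scale E2" and E3: "bilinear_map scale E3"
    and sys: "solves_system scale id R Q E1 E2 E3"
  shows "E1 x y = first_op R Q E2 x y" and "E3 x y = third_op R Q E2 x y" and "graded_product E2"
proof -
  note S = sys[unfolded solves_system_def Let_def id_apply]
  have S5: "E2 x (Q y) = E3 (R x) y - Q (E1 x y) + E1 y (R x)"
    and S6: "E2 x (R y) = R (E2 x y) - E3 y (Q x) + E2 y (R x)"
    and S7: "E2 x y = E2 (R x) y - E1 (Q x) y + E2 x y"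
    and S11: "R (E2 x y - E2 y x) - 2 *s (E2 x y - E2 y x) - (E2 x y - E2 y x) = 0"
    and S14: "E2 (R x - x) y - 2 *s E2 y (R x - x) = E3 x (Q y) - E1 (Q y) x" for x y
    using S by blast+
  have E1_eq: "E1 x y = E2 (bar R Q x) y" for x y
    using S7[of "inv Q x" y] by (simp add: bar_def)
  then show "E1 x y = first_op R Q E2 x y"
    by (simp add: first_op_def)
  have "E3 x y = R (E2 (inv Q y) x) + E2 x (R (inv Q y)) - E2 (inv Q y) (R x)"
    using S6[of "inv Q y" x] by (simp add: algebra_simps)
  then show "E3 x y = third_op R Q E2 x y"
    by (simp add: third_op_def bar_def)
  note E = bilinear_mapD[OF E1] bilinear_mapD[OF E2] bilinear_mapD[OF E3]
  have E1_weight: "E1 x y = s *s E2 x y" if "wt r s x" for r s x y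
    unfolding E1_eq bar_weight[OF that] E ..
  have rel:
    "(p - 1) * ((3 - 2 * t) * \<phi> (E2 x y) + (3 - 2 * r) * \<phi> (E2 y x)) = 0"
    "(w * (2 - p) - s * (2 - r) * (u * (2 - t))) * \<phi> (E2 x y) = 0"
    if x: "wt r s x" and y: "wt t u y" and \<phi>: "wt_functional p w \<phi>" for r s x t u y p w \<phi>
  proof -
    \<comment> \<open>Rewriting with these rules turns all operators into eigenvalues and leaves
      scalar equations in the values of \<phi>.\<close>
    note eval = wtD(5,6)[OF x] wtD(5,6)[OF y] wt_functionalD(3-9)[OF \<phi>] E
      E1_weight[OF x] E1_weight[OF y]
    have S5': "t * u * \<phi> (E2 x y) = r * \<phi> (E3 x y) - p * w * (s * \<phi> (E2 x y)) + r * (u * \<phi> (E2 y x))"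
      using arg_cong[OF S5[of x y], of \<phi>] unfolding eval .
    have S6': "t * \<phi> (E2 x y) = p * \<phi> (E2 x y) - r * s * \<phi> (E3 y x) + r * \<phi> (E2 y x)"
      "r * \<phi> (E2 y x) = p * \<phi> (E2 y x) - t * u * \<phi> (E3 x y) + t * \<phi> (E2 x y)"
      using arg_cong[OF S6[of x y], of \<phi>] arg_cong[OF S6[of y x], of \<phi>] unfolding eval .
    have S11': "(p - 3) * (\<phi> (E2 x y) - \<phi> (E2 y x)) = 0"
      using arg_cong[OF S11[of x y], of \<phi>] unfolding eval by algebra
    have S14': "(r - 1) * (\<phi> (E2 x y) - 2 * \<phi> (E2 y x)) = t * u * (\<phi> (E3 x y) - u * \<phi> (E2 y x))"
      "(t - 1) * (\<phi> (E2 y x) - 2 * \<phi> (E2 x y)) = r * s * (\<phi> (E3 y x) - s * \<phi> (E2 x y))"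
      using arg_cong[OF S14[of x y], of \<phi>] arg_cong[OF S14[of y x], of \<phi>] unfolding eval by algebra+
    note rel = scalar_relations[OF two_nz three_nz wtD(1)[OF x] wtD(1)[OF y] wt_functionalD(1)[OF \<phi>]
        wtD(3)[OF x] wtD(3)[OF y] S5' S6' S11' S14']
    show "(p - 1) * ((3 - 2 * t) * \<phi> (E2 x y) + (3 - 2 * r) * \<phi> (E2 y x)) = 0"
      by (rule rel(1))
    show "(w * (2 - p) - s * (2 - r) * (u * (2 - t))) * \<phi> (E2 x y) = 0"
      by (rule rel(2))
  qed
  \<comment> \<open>For \<open>L = id\<close> the operator in (S11) is \<open>R - 3\<close>.\<close>
  have sym: "R (E2 x y - E2 y x) = 3 *s (E2 x y - E2 y x)" for x y
    using S11[of x y] unfolding scale_three by (simp add: algebra_simps)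
  have skew: "\<forall>x y. R (E2 x (3 *s y - 2 *s R y) + E2 y (3 *s x - 2 *s R x)) =
      E2 x (3 *s y - 2 *s R y) + E2 y (3 *s x - 2 *s R x)"
  proof (rule biadditive_eqI)
    fix r s x t u y p w \<phi>
    assume x: "wt r s x" and y: "wt t u y" and \<phi>: "wt_functional p w \<phi>"
    note eval = wtD(5,6)[OF x] wtD(5,6)[OF y] wt_functionalD(3-9)[OF \<phi>] E
    show "\<phi> (R (E2 x (3 *s y - 2 *s R y) + E2 y (3 *s x - 2 *s R x))) =
      \<phi> (E2 x (3 *s y - 2 *s R y) + E2 y (3 *s x - 2 *s R x))"
      using rel(1)[OF x y \<phi>] unfolding eval by algebra
  qed (simp_all add: E R_simps algebra_simps)
  have aut: "\<forall>x y. T (E2 x y) = E2 (T x) (T y)"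
  proof (rule biadditive_eqI)
    fix r s x t u y p w \<phi>
    assume x: "wt r s x" and y: "wt t u y" and \<phi>: "wt_functional p w \<phi>"
    note eval = wtD(7)[OF x] wtD(7)[OF y] wt_functionalD(3-9)[OF \<phi>] wt_functional_T[OF \<phi>] E
    show "\<phi> (T (E2 x y)) = \<phi> (E2 (T x) (T y))"
      using rel(2)[OF x y \<phi>] unfolding eval by algebra
  qed (simp_all add: E T_simps)
  show "graded_product E2"
    unfolding graded_product_def using sym skew aut by blast
qed

section \<open>From graded products to solutions\<close>

lemma bilinear_first_op:
  assumes "bilinear_map scale f"
  shows "bilinear_map scale (first_op R Q f)"
  unfolding bilinear_map_def Vector_Spaces.linear_iff first_op_def bar_def
  by (simp add: vector_space_axioms bilinear_mapD[OF assms] R_simps linearD[OF linear_inv_Q])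

lemma bilinear_third_op:
  assumes "bilinear_map scale f"
  shows "bilinear_map scale (third_op R Q f)"
  unfolding bilinear_map_def Vector_Spaces.linear_iff third_op_def bar_def
  by (simp add: vector_space_axioms bilinear_mapD[OF assms] R_simps linearD[OF linear_inv_Q] algebra_simps)

text \<open>(S1)-(S3) are trivial for \<open>L = id\<close>, (S6) and (S7) hold by construction of
  the third and first operation, and (S11) is part of the grading. (S8) and (S10) follow from the
  values on weight vectors, the others from \<open>scalar_relations_converse\<close>.\<close>

theorem graded_product_imp_solution:
  assumes f: "bilinear_map scale f" and graded: "graded_product f"
  shows "solves_system scale id R Q (first_op R Q f) f (third_op R Q f)"
proof -
  define E1 where "E1 = first_op R Q f"
  define E3 where "E3 = third_op R Q f"
  note E = bilinear_mapD[OF bilinear_first_op[OF f], folded E1_def] bilinear_mapD[OF f]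
    bilinear_mapD[OF bilinear_third_op[OF f], folded E3_def]
  have E1_weight: "E1 x y = s *s f x y" if "wt r s x" for r s x y
    unfolding E1_def first_op_def by (simp add: bar_weight[OF that] E)
  \<comment> \<open>\<open>inv Q\<close> acts on \<open>y\<close> as \<open>u / t\<close>; the
    factor \<open>t * u\<close> clears this denominator because \<open>u * u = 1\<close>.\<close>
  have E3_weight: "t * u * \<phi> (E3 x y) = (p - r) * \<phi> (f y x) + t * \<phi> (f x y)"
    if x: "wt r s x" and y: "wt t u y" and \<phi>: "wt_functional p w \<phi>" for r s x t u y p w \<phi>
  proof -
    have "\<phi> (E3 x y) = p * (u / t * \<phi> (f y x)) + u * \<phi> (f x y) - u / t * (r * \<phi> (f y x))"
      unfolding E3_def third_op_def
      by (simp add: bar_weight[OF y] inv_Q_weight[OF y] wtD(5)[OF x] E wt_functionalD(3-9)[OF \<phi>])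
    moreover have "t * (u / t) = u"
      using wtD(4)[OF y] by simp
    ultimately show ?thesis
      using wtD(3)[OF y] by algebra
  qed
  have rel:
    "p * \<phi> (E3 x y) = p * w * \<phi> (E3 y x)"
    "t * u * \<phi> (f x y) = r * \<phi> (E3 x y) - p * w * (s * \<phi> (f x y)) + r * (u * \<phi> (f y x))"
    "t * u * (s * \<phi> (f x y)) = r * s * \<phi> (E3 x y) - p * w * \<phi> (f x y) + r * s * (u * \<phi> (f y x))"
    "(r - 3) * (\<phi> (E3 x y) - u * \<phi> (f y x)) = 0"
    "(p - 1) * (\<phi> (E3 x y) - u * \<phi> (f y x)) + t * u * \<phi> (f y x) - t * \<phi> (E3 x y) = (r - 1) * (u * \<phi> (f y x))"
    "(r - 1) * (\<phi> (f x y) - 2 * \<phi> (f y x)) = t * u * (\<phi> (E3 x y) - u * \<phi> (f y x))"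
    if x: "wt r s x" and y: "wt t u y" and \<phi>: "wt_functional p w \<phi>" for r s x t u y p w \<phi>
  proof -
    note eval = wtD(5,6,7)[OF x] wtD(5,6,7)[OF y] wt_functionalD(3-9)[OF \<phi>] wt_functional_T[OF \<phi>] E
    have "R (f x y - f y x) = 3 *s (f x y - f y x)"
      using graded by (simp add: graded_product_def)
    from arg_cong[OF this, of \<phi>] have 1: "(p - 3) * (\<phi> (f x y) - \<phi> (f y x)) = 0"
      unfolding eval by algebra
    have "R (f x (3 *s y - 2 *s R y) + f y (3 *s x - 2 *s R x)) =
        f x (3 *s y - 2 *s R y) + f y (3 *s x - 2 *s R x)"
      using graded unfolding graded_product_def by blast
    from arg_cong[OF this, of \<phi>]
    have 2: "(p - 1) * ((3 - 2 * t) * \<phi> (f x y) + (3 - 2 * r) * \<phi> (f y x)) = 0"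
      unfolding eval by algebra
    have "T (f x y) = f (T x) (T y)"
      using graded by (simp add: graded_product_def)
    from arg_cong[OF this, of \<phi>]
    have 3: "(w * (2 - p) - s * (2 - r) * (u * (2 - t))) * \<phi> (f x y) = 0"
      unfolding eval by algebra
    note rel = scalar_relations_converse[OF two_nz three_nz wtD(1)[OF x] wtD(1)[OF y] wt_functionalD(1)[OF \<phi>]
        wtD(3)[OF x] wtD(3)[OF y] 1 2 3 E3_weight[OF x y \<phi>] E3_weight[OF y x \<phi>]]
    show "p * \<phi> (E3 x y) = p * w * \<phi> (E3 y x)"
    "t * u * \<phi> (f x y) = r * \<phi> (E3 x y) - p * w * (s * \<phi> (f x y)) + r * (u * \<phi> (f y x))"
    "t * u * (s * \<phi> (f x y)) = r * s * \<phi> (E3 x y) - p * w * \<phi> (f x y) + r * s * (u * \<phi> (f y x))"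
    "(r - 3) * (\<phi> (E3 x y) - u * \<phi> (f y x)) = 0"
    "(p - 1) * (\<phi> (E3 x y) - u * \<phi> (f y x)) + t * u * \<phi> (f y x) - t * \<phi> (E3 x y) = (r - 1) * (u * \<phi> (f y x))"
    "(r - 1) * (\<phi> (f x y) - 2 * \<phi> (f y x)) = t * u * (\<phi> (E3 x y) - u * \<phi> (f y x))"
      by (fact rel)+
  qed
  note additive = E R_simps Q_simps algebra_simps
  have S4: "\<forall>x y. E3 x y = R (E3 x y) - Q (E3 y x) + E3 x y"
  proof (rule biadditive_eqI)
    fix r s x t u y p w \<phi>
    assume x: "wt r s x" and y: "wt t u y" and \<phi>: "wt_functional p w \<phi>"
    show "\<phi> (E3 x y) = \<phi> (R (E3 x y) - Q (E3 y x) + E3 x y)"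
      using rel(1)[OF x y \<phi>] unfolding wt_functionalD(3-9)[OF \<phi>] by algebra
  qed (simp_all add: additive)
  have S5: "\<forall>x y. f x (Q y) = E3 (R x) y - Q (E1 x y) + E1 y (R x)"
  proof (rule biadditive_eqI)
    fix r s x t u y p w \<phi>
    assume x: "wt r s x" and y: "wt t u y" and \<phi>: "wt_functional p w \<phi>"
    note eval = wtD(5,6)[OF x] wtD(5,6)[OF y] wt_functionalD(3-9)[OF \<phi>] E E1_weight[OF x] E1_weight[OF y]
    show "\<phi> (f x (Q y)) = \<phi> (E3 (R x) y - Q (E1 x y) + E1 y (R x))"
      using rel(2)[OF x y \<phi>] unfolding eval .
  qed (simp_all add: additive)
  have S6: "f x (R y) = R (f x y) - E3 y (Q x) + f y (R x)" for x y
    unfolding E3_def third_op_def bar_def by simp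
  have S7: "f x y = f (R x) y - E1 (Q x) y + f x y" for x y
    unfolding E1_def first_op_def bar_def by simp
  have S8: "\<forall>x y. E1 x (R y) = R (E1 x y) - E3 y (R x) + f y (Q x)"
  proof (rule biadditive_eqI)
    fix r s x t u y p w \<phi>
    assume x: "wt r s x" and y: "wt t u y" and \<phi>: "wt_functional p w \<phi>"
    note eval = wtD(5,6)[OF x] wtD(5,6)[OF y] wt_functionalD(3-9)[OF \<phi>] E E1_weight[OF x] E1_weight[OF y]
    show "\<phi> (E1 x (R y)) = \<phi> (R (E1 x y) - E3 y (R x) + f y (Q x))"
      using E3_weight[OF y x \<phi>] wtD(3)[OF x] unfolding eval by algebra
  qed (simp_all add: additive)
  have S9: "\<forall>x y. E1 x (Q y) = E3 (Q x) y - Q (f x y) + E1 y (Q x)"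
  proof (rule biadditive_eqI)
    fix r s x t u y p w \<phi>
    assume x: "wt r s x" and y: "wt t u y" and \<phi>: "wt_functional p w \<phi>"
    note eval = wtD(5,6)[OF x] wtD(5,6)[OF y] wt_functionalD(3-9)[OF \<phi>] E E1_weight[OF x] E1_weight[OF y]
    show "\<phi> (E1 x (Q y)) = \<phi> (E3 (Q x) y - Q (f x y) + E1 y (Q x))"
      using rel(3)[OF x y \<phi>] unfolding eval .
  qed (simp_all add: additive)
  have S10: "\<forall>x y. E1 x y = f (Q x) y - E1 (R x) y + E1 x y"
  proof (rule biadditive_eqI)
    fix r s x t u y p w \<phi>
    assume x: "wt r s x" and y: "wt t u y" and \<phi>: "wt_functional p w \<phi>"
    note eval = wtD(5,6)[OF x] wtD(5,6)[OF y] wt_functionalD(3-9)[OF \<phi>] E E1_weight[OF x] E1_weight[OF y]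
    show "\<phi> (E1 x y) = \<phi> (f (Q x) y - E1 (R x) y + E1 x y)"
      unfolding eval by simp
  qed (simp_all add: additive)
  have S11: "R (f x y - f y x) - 2 *s (f x y - f y x) - (f x y - f y x) = 0" for x y
    using graded unfolding graded_product_def scale_three by simp
  have S12: "\<forall>x y. E3 (R x - 2 *s x - x) y - E1 y (R x - 2 *s x - x) = 0"
  proof (rule biadditive_eqI[where G = "\<lambda>_ _. 0"])
    fix r s x t u y p w \<phi>
    assume x: "wt r s x" and y: "wt t u y" and \<phi>: "wt_functional p w \<phi>"
    note eval = wtD(5,6)[OF x] wtD(5,6)[OF y] wt_functionalD(3-9)[OF \<phi>] E E1_weight[OF x] E1_weight[OF y]
    show "\<phi> (E3 (R x - 2 *s x - x) y - E1 y (R x - 2 *s x - x)) = \<phi> 0"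
      using rel(4)[OF x y \<phi>] unfolding eval by algebra
  qed (simp_all add: additive)
  have S13: "\<forall>x y. (R (E3 x y - E1 y x) - (E3 x y - E1 y x)) + E1 (R y) x - E3 x (R y) = E1 y (R x - x)"
  proof (rule biadditive_eqI)
    fix r s x t u y p w \<phi>
    assume x: "wt r s x" and y: "wt t u y" and \<phi>: "wt_functional p w \<phi>"
    note eval = wtD(5,6)[OF x] wtD(5,6)[OF y] wt_functionalD(3-9)[OF \<phi>] E E1_weight[OF x] E1_weight[OF y]
    show "\<phi> ((R (E3 x y - E1 y x) - (E3 x y - E1 y x)) + E1 (R y) x - E3 x (R y)) = \<phi> (E1 y (R x - x))"
      using rel(5)[OF x y \<phi>] unfolding eval by algebra
  qed (simp_all add: additive)
  have S14: "\<forall>x y. f (R x - x) y - 2 *s f y (R x - x) = E3 x (Q y) - E1 (Q y) x"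
  proof (rule biadditive_eqI)
    fix r s x t u y p w \<phi>
    assume x: "wt r s x" and y: "wt t u y" and \<phi>: "wt_functional p w \<phi>"
    note eval = wtD(5,6)[OF x] wtD(5,6)[OF y] wt_functionalD(3-9)[OF \<phi>] E E1_weight[OF x] E1_weight[OF y]
    show "\<phi> (f (R x - x) y - 2 *s f y (R x - x)) = \<phi> (E3 x (Q y) - E1 (Q y) x)"
      using rel(6)[OF x y \<phi>] unfolding eval by algebra
  qed (simp_all add: additive)
  have "solves_system scale id R Q E1 f E3"
    unfolding solves_system_def Let_def id_apply
    using S4 S5 S6 S7 S8 S9 S10 S11 S12 S13 S14 by (intro conjI) (blast | simp; fail)+
  then show ?thesis
    unfolding E1_def E3_def .
qed

section \<open>Components in the eigenspaces of \<open>R\<close>\<close>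

text \<open>The eigenvalues 1 and 3 are the roots of X^2 - 4 X + 3.\<close>

lemma R_R: "R (R z) = 4 *s R z - 3 *s z"
proof (induction z rule: weight_induct)
  case (weight r s z)
  have "r * r = 4 * r - 3"
    using wtD(1)[OF weight] by auto
  then have "(r * r) *s z = (4 * r) *s z - 3 *s z"
    by (simp only: scale_left_diff_distrib)
  then show ?case
    by (simp add: wtD(5)[OF weight] R_simps)
qed (simp add: R_simps algebra_simps)

lemma T_T: "T (T z) = z"
proof (induction z rule: weight_induct)
  case (weight r s z)
  have "s * (2 - r) * (s * (2 - r)) = 1"
    using wtD(1,2)[OF weight] by (elim disjE) simp_all
  then show ?case
    by (simp add: wtD(7)[OF weight] T_simps)
qed (simp add: T_simps)

text \<open>\<open>T\<close> is linear and acts on weight vectors by signs, hence is its own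
  inverse; only multiplicativity remains.\<close>

lemma involutive_automorphism_iff: "involutive_automorphism scale f T \<longleftrightarrow> (\<forall>x y. T (f x y) = f (T x) (T y))"
proof -
  have "bij T"
    by (rule o_bij[of T]) (auto simp: T_T)
  then show ?thesis
    by (simp add: involutive_automorphism_def linear_T T_T)
qed

text \<open>Interpolation at the eigenvalues 1 and 3: (3 - R) / 2 and (R - 1) / 2 are the
  projections onto the two eigenspaces of \<open>R\<close>.\<close>

definition R1_part :: "'u \<Rightarrow> 'u"
  where "R1_part z = inverse 2 *s (3 *s z - R z)"

definition R3_part :: "'u \<Rightarrow> 'u"
  where "R3_part z = inverse 2 *s (R z - z)"

lemma R3_part_simps:
  "R3_part (x + y) = R3_part x + R3_part y" "R3_part (c *s x) = c *s R3_part x" "R3_part 0 = 0"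
  by (simp_all add: R3_part_def R_simps algebra_simps)

lemma scale_four: "4 *s x = 3 *s x + x"
  using scale_left_distrib[of 3 1 x] by simp

lemma R_R1_part: "R (R1_part z) = R1_part z"
proof -
  have "3 *s R z - R (R z) = 3 *s z - R z"
    unfolding R_R scale_four by simp
  then show ?thesis
    unfolding R1_part_def R_simps by (rule arg_cong)
qed

lemma R_R3_part: "R (R3_part z) = 3 *s R3_part z"
proof -
  have "R (R z) - R z = 3 *s (R z - z)"
    unfolding R_R scale_four scale_right_diff_distrib by simp
  then show ?thesis
    unfolding R3_part_def R_simps by (simp add: mult.commute)
qed

lemma R1_part_add_R3_part: "R1_part z + R3_part z = z"
proof -
  have "R1_part z + R3_part z = inverse 2 *s (2 *s z)"
    unfolding R1_part_def R3_part_def scale_three by (simp add: algebra_simps)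
  then show ?thesis
    using two_nz by simp
qed

text \<open>Uniqueness of the eigenspace decomposition, used to recognise a given \<open>A3\<close>
  as \<open>R3_part\<close> of the product.\<close>

lemma R3_part_eqI:
  assumes "R x = x" "R y = 3 *s y"
  shows "R3_part (x + y) = y"
proof -
  have "R3_part (x + y) = inverse 2 *s (2 *s y)"
    unfolding R3_part_def R_simps assms scale_three by simp
  then show ?thesis
    using two_nz by simp
qed

text \<open>The commutator of \<open>f\<close> lies in the eigenspace of 3, which 3 - R
  annihilates.\<close>

lemma graded_product_R1_part:
  assumes "graded_product f"
  shows "R1_part (f x y) = R1_part (f y x)"
proof -
  have "R (f x y - f y x) = 3 *s (f x y - f y x)"
    using assms by (simp add: graded_product_def)
  then have "3 *s f x y - R (f x y) = 3 *s f y x - R (f y x)"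
    by (simp add: R_simps algebra_simps)
  then show ?thesis
    by (simp add: R1_part_def)
qed

text \<open>On eigenvectors the second graded identity puts
  \<open>(3 - 2 * t) *s f x y + (3 - 2 * r) *s f y x\<close> in the eigenspace of 1, so its
  component for 3 vanishes.\<close>

lemma graded_product_R3_part:
  assumes f: "bilinear_map scale f" and graded: "graded_product f"
    and x: "R x = r *s x" and y: "R y = t *s y"
  shows "(3 - 2 * t) *s R3_part (f x y) + (3 - 2 * r) *s R3_part (f y x) = 0"
proof -
  let ?z = "f x (3 *s y - 2 *s R y) + f y (3 *s x - 2 *s R x)"
  have z: "?z = (3 - 2 * t) *s f x y + (3 - 2 * r) *s f y x"
    by (simp add: x y bilinear_mapD[OF f] scale_left_diff_distrib)
  have "R ?z = ?z"
    using graded unfolding graded_product_def by blast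
  then have "R3_part ?z = 0"
    by (simp add: R3_part_def)
  then show ?thesis
    unfolding z R3_part_simps .
qed

text \<open>Symmetry removes \<open>A\<close> from the commutator, leaving eigenvalue 3; skewness
  removes \<open>B\<close> from the weighted sum \<open>?z\<close>, leaving eigenvalue 1. The latter
  is bilinear and is checked on weight vectors.\<close>

lemma graded_productI:
  assumes f: "bilinear_map scale f" and sum: "\<And>x y. f x y = A x y + B x y"
    and A: "\<And>x y. R (A x y) = A x y" and B: "\<And>x y. R (B x y) = 3 *s B x y"
    and sym: "\<And>x y. A x y = A y x"
    and skew: "\<And>r s x t u y. wt r s x \<Longrightarrow> wt t u y \<Longrightarrow> (3 - 2 * t) *s B x y + (3 - 2 * r) *s B y x = 0"
    and aut: "\<And>x y. T (f x y) = f (T x) (T y)"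
  shows "graded_product f"
proof -
  let ?z = "\<lambda>x y. f x (3 *s y - 2 *s R y) + f y (3 *s x - 2 *s R x)"
  note f_simps = bilinear_mapD[OF f]
  have "R (?z x y) - ?z x y = 0" for x y
  proof (rule biadditive_zeroI[where F = "\<lambda>x y. R (?z x y) - ?z x y"])
    fix r s x t u y
    assume x: "wt r s x" and y: "wt t u y"
    have "?z x y = (3 - 2 * t) *s f x y + (3 - 2 * r) *s f y x"
      by (simp add: wtD(5)[OF x] wtD(5)[OF y] f_simps scale_left_diff_distrib)
    also have "\<dots> = ((3 - 2 * t) *s A x y + (3 - 2 * r) *s A y x) + ((3 - 2 * t) *s B x y + (3 - 2 * r) *s B y x)"
      unfolding sum scale_right_distrib by (simp add: ac_simps)
    also have "\<dots> = (3 - 2 * t) *s A x y + (3 - 2 * r) *s A y x"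
      using skew[OF x y] by simp
    finally show "R (?z x y) - ?z x y = 0"
      by (simp add: R_simps A)
  qed (simp_all add: f_simps R_simps algebra_simps)
  then have skew': "R (?z x y) = ?z x y" for x y
    by simp
  have "f x y - f y x = B x y - B y x" for x y
    by (simp add: sum sym[of x y])
  then have "R (f x y - f y x) = 3 *s (f x y - f y x)" for x y
    by (simp add: R_simps B scale_right_diff_distrib)
  with skew' aut show ?thesis
    by (simp add: graded_product_def)
qed

end

section \<open>Transfer to the given decomposition of the space\<close>

lemma nonzero_if_CHAR:
  assumes "CHAR('k::field) \<notin> {2, 3, 5}"
  shows "(2::'k) \<noteq> 0" "(3::'k) \<noteq> 0"
proof -
  have *: "CHAR('k) \<noteq> 1" by simp
  show "(2::'k) \<noteq> 0"
  proof
    assume "(2::'k) = 0"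
    then have dvd: "CHAR('k) dvd 2"
      using of_nat_eq_0_iff_char_dvd[of 2, where 'a = 'k] by simp
    then have "CHAR('k) \<le> 2" "CHAR('k) \<noteq> 0"
      by (auto dest: dvd_imp_le intro: ccontr)
    moreover have "CHAR('k) \<noteq> 2" "CHAR('k) \<noteq> 3"
      using assms by auto
    ultimately show False
      using * by arith
  qed
  show "(3::'k) \<noteq> 0"
  proof
    assume "(3::'k) = 0"
    then have dvd: "CHAR('k) dvd 3"
      using of_nat_eq_0_iff_char_dvd[of 3, where 'a = 'k] by simp
    then have "CHAR('k) \<le> 3" "CHAR('k) \<noteq> 0"
      by (auto dest: dvd_imp_le intro: ccontr)
    moreover have "CHAR('k) \<noteq> 2" "CHAR('k) \<noteq> 3"
      using assms by auto
    ultimately show False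
      using * by arith
  qed
qed

theorem theorem3p1:
  fixes scale :: "'k::field \<Rightarrow> 'u::ab_group_add \<Rightarrow> 'u"
    and U11p U11m U13p U13m U11 U13 Up Um :: "'u set"
    and L R Q T :: "'u \<Rightarrow> 'u"
  assumes char: "CHAR('k) \<notin> {2, 3, 5}"
    and vs: "vector_space scale"
    and sum: "internal_direct_sum4 scale U11p U11m U13p U13m"
    and U11: "U11 = U11p + U11m"
    and U13: "U13 = U13p + U13m"
    and Up: "Up = U11p + U13m"
    and Um: "Um = U11m + U13p"
    and L: "L = id"
    and R: "Vector_Spaces.linear scale scale R"
      "\<forall>x\<in>U11. R x = x" "\<forall>x\<in>U13. R x = scale 3 x"
    and Q: "Vector_Spaces.linear scale scale Q"
      "\<forall>x\<in>U11p. Q x = x" "\<forall>x\<in>U11m. Q x = - x"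
      "\<forall>x\<in>U13p. Q x = scale 3 x" "\<forall>x\<in>U13m. Q x = - scale 3 x"
    and T: "Vector_Spaces.linear scale scale T"
      "\<forall>x\<in>Up. T x = x" "\<forall>x\<in>Um. T x = - x"
  shows "bij Q \<and>
    (\<forall>x \<in> U11p + U13p. bar R Q x = x) \<and>
    (\<forall>x \<in> U11m + U13m. bar R Q x = - x) \<and>
    (\<forall>E1 E2 E3.
      bilinear_map scale E1 \<and> bilinear_map scale E2 \<and> bilinear_map scale E3 \<and>
      solves_system scale L R Q E1 E2 E3 \<longrightarrow>
      (\<exists>A1 A3.
        (\<forall>x y. A1 x y \<in> U11 \<and> A3 x y \<in> U13 \<and> E2 x y = A1 x y + A3 x y) \<and>
        commutative_op A1 \<and>
        parity_skew scale U11 U13 A3 \<and>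
        (\<forall>x\<in>U11. \<forall>y\<in>U11. A3 x y = - A3 y x) \<and>
        (\<forall>x\<in>U13. \<forall>y\<in>U13. A3 x y = - A3 y x) \<and>
        (\<forall>x\<in>U13. \<forall>y\<in>U11. A3 x y = scale 3 (A3 y x))) \<and>
      involutive_automorphism scale E2 T \<and>
      (\<forall>x\<in>Up. \<forall>y\<in>Up. E2 x y \<in> Up) \<and>
      (\<forall>x\<in>Um. \<forall>y\<in>Um. E2 x y \<in> Up) \<and>
      (\<forall>x\<in>Um. \<forall>y\<in>Up. E2 x y \<in> Um) \<and>
      (\<forall>x\<in>Up. \<forall>y\<in>Um. E2 x y \<in> Um) \<and>
      (\<forall>x y. E1 x y = first_op R Q E2 x y) \<and>
      (\<forall>x y. E3 x y = third_op R Q E2 x y)) \<and>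
    (\<forall>f A1 A3.
      bilinear_map scale f \<and>
      (\<forall>x y. A1 x y \<in> U11 \<and> A3 x y \<in> U13 \<and> f x y = A1 x y + A3 x y) \<and>
      involutive_automorphism scale f T \<and>
      commutative_op A1 \<and>
      parity_skew scale U11 U13 A3 \<longrightarrow>
      bilinear_map scale (first_op R Q f) \<and> bilinear_map scale (third_op R Q f) \<and>
      solves_system scale L R Q (first_op R Q f) f (third_op R Q f))"
proof -
  interpret V: vector_space scale by (fact vs)
  note nz = nonzero_if_CHAR[OF char]
  let ?wt = "weight_vector scale R Q"
  have sub: "V.subspace U11p" "V.subspace U11m" "V.subspace U13p" "V.subspace U13m"
    using sum by (simp_all add: internal_direct_sum4_def)
  note zero = sub[THEN V.subspace_0]
  have in_sum: "a \<in> A + B" "a \<in> B + A" if "a \<in> A" "0 \<in> B" for a :: 'u and A B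
    using set_plus_intro[OF that] set_plus_intro[OF that(2,1)] by simp_all
  have mem: "a \<in> U11p \<Longrightarrow> a \<in> U11 \<and> a \<in> Up" "a \<in> U11m \<Longrightarrow> a \<in> U11 \<and> a \<in> Um"
    "a \<in> U13p \<Longrightarrow> a \<in> U13 \<and> a \<in> Um" "a \<in> U13m \<Longrightarrow> a \<in> U13 \<and> a \<in> Up" for a
    unfolding U11 U13 Up Um by (simp_all add: in_sum zero)
  have wts: "a \<in> U11p \<Longrightarrow> ?wt 1 1 a" "a \<in> U11m \<Longrightarrow> ?wt 1 (-1) a"
    "a \<in> U13p \<Longrightarrow> ?wt 3 1 a" "a \<in> U13m \<Longrightarrow> ?wt 3 (-1) a" for a
    using mem[of a] R(2,3) Q(2-5) by (simp_all add: weight_vector_def)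
  have "(\<lambda>(a, b, c, d). a + b + c + d) ` (U11p \<times> U11m \<times> U13p \<times> U13m) = UNIV"
    using sum by (simp add: internal_direct_sum4_def bij_betw_def)
  then have decomp: "\<exists>a\<in>U11p. \<exists>b\<in>U11m. \<exists>c\<in>U13p. \<exists>d\<in>U13m. x = a + b + c + d" for x
    by (force simp: set_eq_iff image_iff)
  have T_sign: "T a = a" if "a \<in> U11p \<union> U13m" for a
    using that mem T(2) by blast
  have T_sign': "T a = - a" if "a \<in> U11m \<union> U13p" for a
    using that mem T(3) by blast
  have double: "z = 0" if "scale 2 z = 0" for z
    using that nz by simp
  \<comment> \<open>Expanding numerals into sums reduces the comparisons of components below to
    cancellation in the additive group.\<close>
  have two_scale: "scale 2 z = z + z" for z
    using V.scale_left_distrib[of 1 1 z] by simp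
  have three_scale: "scale 3 z = z + z + z" for z
    using V.scale_left_distrib[of 1 2 z] by (simp add: two_scale add.assoc)
  \<comment> \<open>Membership in the subspaces becomes an eigenvalue equation: comparing components
    shows that twice the unwanted part vanishes, and 2 is invertible.\<close>
  have U11_iff: "x \<in> U11 \<longleftrightarrow> R x = x" for x
  proof
    assume "R x = x"
    obtain a b c d where x: "x = a + b + c + d" and in_U: "a \<in> U11p" "b \<in> U11m" "c \<in> U13p" "d \<in> U13m"
      using decomp by blast
    then have "R x = a + b + scale 3 c + scale 3 d"
      using mem R(2,3) by (simp add: linearD[OF R(1)])
    with \<open>R x = x\<close> have "scale 2 (c + d) = 0"
      unfolding x two_scale three_scale by (simp add: algebra_simps)
    then have "x = a + b"
      using double x by (simp add: add.assoc)
    then show "x \<in> U11"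
      unfolding U11 using in_U by (simp add: set_plus_intro)
  qed (use R(2) in blast)
  have U13_iff: "x \<in> U13 \<longleftrightarrow> R x = scale 3 x" for x
  proof
    assume "R x = scale 3 x"
    obtain a b c d where x: "x = a + b + c + d" and in_U: "a \<in> U11p" "b \<in> U11m" "c \<in> U13p" "d \<in> U13m"
      using decomp by blast
    then have "R x = a + b + scale 3 c + scale 3 d"
      using mem R(2,3) by (simp add: linearD[OF R(1)])
    with \<open>R x = scale 3 x\<close> have "scale 2 (a + b) = 0"
      unfolding x two_scale three_scale by (simp add: algebra_simps)
    then have "x = c + d"
      using double x by (simp add: add.assoc)
    then show "x \<in> U13"
      unfolding U13 using in_U by (simp add: set_plus_intro)
  qed (use R(3) in blast)
  have Up_iff: "x \<in> Up \<longleftrightarrow> T x = x" for x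
  proof
    assume "T x = x"
    obtain a b c d where x: "x = a + b + c + d" and in_U: "a \<in> U11p" "b \<in> U11m" "c \<in> U13p" "d \<in> U13m"
      using decomp by blast
    then have "T x = a - b - c + d"
      by (simp add: linearD[OF T(1)] T_sign T_sign')
    with \<open>T x = x\<close> have "scale 2 (b + c) = 0"
      unfolding x two_scale by (simp add: algebra_simps)
    then have "x = a + d"
      using double[of "b + c"] x by (simp add: add.assoc add_eq_0_iff)
    then show "x \<in> Up"
      unfolding Up using in_U by (simp add: set_plus_intro)
  qed (use T(2) in blast)
  have Um_iff: "x \<in> Um \<longleftrightarrow> T x = - x" for x
  proof
    assume "T x = - x"
    obtain a b c d where x: "x = a + b + c + d" and in_U: "a \<in> U11p" "b \<in> U11m" "c \<in> U13p" "d \<in> U13m"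
      using decomp by blast
    then have T_x: "T x = a - b - c + d"
      by (simp add: linearD[OF T(1)] T_sign T_sign')
    \<comment> \<open>Adding \<open>x\<close> to \<open>T x\<close> cancels \<open>b\<close> and
      \<open>c\<close> and doubles \<open>a + d\<close>.\<close>
    have "(a - b - c + d) + x = 0"
      unfolding T_x[symmetric] using \<open>T x = - x\<close> by simp
    then have "scale 2 (a + d) = 0"
      unfolding x two_scale by (simp add: algebra_simps)
    then have "x = b + c"
      using double[of "a + d"] x by (simp add: ac_simps add_eq_0_iff)
    then show "x \<in> Um"
      unfolding Um using in_U by (simp add: set_plus_intro)
  qed (use T(3) in blast)
  interpret weight_space scale R Q T
  proof
    \<comment> \<open>5 - 2 R is 3 on \<open>U11\<close> and -1 on \<open>U13\<close>; followed by
      \<open>Q\<close> it gives 3, -3, -3, 3 on the four summands.\<close>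
    show "scale 3 (T x) = Q (scale 5 x - scale 2 (R x))" for x
    proof -
      obtain a b c d where x: "x = a + b + c + d" and in_U: "a \<in> U11p" "b \<in> U11m" "c \<in> U13p" "d \<in> U13m"
        using decomp by blast
      have "R a = a" "R b = b" "R c = scale 3 c" "R d = scale 3 d"
        using in_U mem R(2,3) by blast+
      moreover have "Q a = a" "Q b = - b" "Q c = scale 3 c" "Q d = - scale 3 d"
        using in_U Q(2-5) by blast+
      moreover have "T a = a" "T b = - b" "T c = - c" "T d = d"
        using in_U T_sign T_sign' by blast+
      moreover have "scale 5 z = scale 3 z + scale 2 z" for z
        using V.scale_left_distrib[of 3 2 z] by simp
      \<comment> \<open>\<open>V.scale_scale\<close> would merge nested factors into numerals such
        as 6, to which \<open>two_scale\<close> and \<open>three_scale\<close> do not apply.\<close>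
      ultimately show ?thesis
        unfolding x
        by (simp add: linearD[OF R(1)] linearD[OF Q(1)] linearD[OF T(1)] two_scale three_scale algebra_simps
            del: V.scale_scale)
    qed
    show "\<exists>a b c d. x = a + b + c + d \<and> ?wt 1 1 a \<and> ?wt 1 (-1) b \<and> ?wt 3 1 c \<and> ?wt 3 (-1) d" for x
      using decomp[of x] wts by blast
  qed (simp_all add: nz linearD(1,2)[OF R(1)] linearD(1,2)[OF Q(1)] linearD(1,2)[OF T(1)])
  have weight_sum: "x \<in> A + B \<Longrightarrow> (\<And>a. a \<in> A \<Longrightarrow> P a) \<Longrightarrow> (\<And>a. a \<in> B \<Longrightarrow> P a) \<Longrightarrow>
    (\<And>a b. P a \<Longrightarrow> P b \<Longrightarrow> P (a + b)) \<Longrightarrow> P x" for x :: 'u and A B P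
    by (blast elim: set_plus_elim)
  have bar_add: "bar R Q (a + b) = bar R Q a + bar R Q b" for a b
    by (simp add: bar_def linearD[OF linear_inv_Q] R_simps)
  have bar_p: "bar R Q x = x" if "x \<in> U11p + U13p" for x
    using that by (rule weight_sum) (use wts bar_weight in \<open>force simp: bar_add\<close>)+
  have bar_m: "bar R Q x = - x" if "x \<in> U11m + U13m" for x
    using that by (rule weight_sum) (use wts bar_weight in \<open>force simp: bar_add\<close>)+
  \<comment> \<open>Both sides are 1 for \<open>r = 1\<close> and -3 for \<open>r = 3\<close>. Zero
    is excluded because it satisfies both eigenvalue equations.\<close>
  have parity: "(-3) ^ parity U11 x = (3 - 2 * r)" if "R x = scale r x" "r = 1 \<or> r = 3" "x \<noteq> 0" for x r
  proof (cases "x \<in> U11")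
    case True
    then have "r = 1"
      using that U11_iff[of x] V.scale_cancel_right[of r x 1] by simp
    with True show ?thesis by (simp add: parity_def)
  next
    case False
    then have "r = 3"
      using that U11_iff[of x] by auto
    with False show ?thesis by (simp add: parity_def)
  qed
  have R_eigen: "\<exists>r. R x = scale r x \<and> (r = 1 \<or> r = 3)" if "x \<in> U11 \<union> U13" for x
    using that U11_iff U13_iff V.scale_one by (metis UnE)
  have direct: "(\<exists>A1 A3.
        (\<forall>x y. A1 x y \<in> U11 \<and> A3 x y \<in> U13 \<and> E2 x y = A1 x y + A3 x y) \<and>
        commutative_op A1 \<and>
        parity_skew scale U11 U13 A3 \<and>
        (\<forall>x\<in>U11. \<forall>y\<in>U11. A3 x y = - A3 y x) \<and>
        (\<forall>x\<in>U13. \<forall>y\<in>U13. A3 x y = - A3 y x) \<and>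
        (\<forall>x\<in>U13. \<forall>y\<in>U11. A3 x y = scale 3 (A3 y x))) \<and>
      involutive_automorphism scale E2 T \<and>
      (\<forall>x\<in>Up. \<forall>y\<in>Up. E2 x y \<in> Up) \<and>
      (\<forall>x\<in>Um. \<forall>y\<in>Um. E2 x y \<in> Up) \<and>
      (\<forall>x\<in>Um. \<forall>y\<in>Up. E2 x y \<in> Um) \<and>
      (\<forall>x\<in>Up. \<forall>y\<in>Um. E2 x y \<in> Um) \<and>
      (\<forall>x y. E1 x y = first_op R Q E2 x y) \<and>
      (\<forall>x y. E3 x y = third_op R Q E2 x y)"
    if "bilinear_map scale E1" and E2: "bilinear_map scale E2" and "bilinear_map scale E3"
      and "solves_system scale L R Q E1 E2 E3" for E1 E2 E3
  proof -
    note sol = solution_imp_graded_product[OF that(1-3) that(4)[unfolded L]]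
    let ?A1 = "\<lambda>x y. R1_part (E2 x y)" and ?A3 = "\<lambda>x y. R3_part (E2 x y)"
    have components: "?A1 x y \<in> U11 \<and> ?A3 x y \<in> U13 \<and> E2 x y = ?A1 x y + ?A3 x y" for x y
      by (simp add: U11_iff U13_iff R_R1_part R_R3_part R1_part_add_R3_part)
    have comm: "commutative_op ?A1"
      using graded_product_R1_part[OF sol(3)] by (simp add: commutative_op_def)
    note rel = graded_product_R3_part[OF E2 sol(3)]
    \<comment> \<open>At 0 the parity need not match the chosen eigenvalue, so zero arguments are
      settled separately.\<close>
    have zero_arg: "?A3 0 y = 0" "?A3 y 0 = 0" for y
      using bilinear_mapD(3)[OF E2, of 0 0 y] bilinear_mapD(4)[OF E2, of y 0 0] by (simp_all add: R3_part_simps)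
    have skew: "parity_skew scale U11 U13 ?A3"
      unfolding parity_skew_def
    proof (intro ballI)
      fix x y
      assume "x \<in> U11 \<union> U13" "y \<in> U11 \<union> U13"
      then obtain r t where r: "R x = scale r x" "r = 1 \<or> r = 3" and t: "R y = scale t y" "t = 1 \<or> t = 3"
        using R_eigen by blast
      show "scale ((-3) ^ parity U11 y) (?A3 x y) = - scale ((-3) ^ parity U11 x) (?A3 y x)"
      proof (cases "x = 0 \<or> y = 0")
        case True
        then show ?thesis by (auto simp: zero_arg)
      next
        case False
        then show ?thesis
          using parity[OF r] parity[OF t] rel[OF r(1) t(1)] by (simp add: eq_neg_iff_add_eq_0)
      qed
    qed
    have skew11: "?A3 x y = - ?A3 y x" if "x \<in> U11" "y \<in> U11" for x y
      using rel[of x 1 y 1] that by (simp add: U11_iff eq_neg_iff_add_eq_0)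
    have skew13: "?A3 x y = - ?A3 y x" if "x \<in> U13" "y \<in> U13" for x y
    proof -
      \<comment> \<open>For \<open>r = t = 3\<close> both coefficients in \<open>rel\<close> equal
        -3.\<close>
      have "scale (-3) (?A3 x y + ?A3 y x) = 0"
        using rel[of x 3 y 3] that by (simp add: U13_iff V.scale_right_distrib)
      then show ?thesis
        using nz(2) by (simp add: eq_neg_iff_add_eq_0)
    qed
    have skew31: "?A3 x y = scale 3 (?A3 y x)" if "x \<in> U13" "y \<in> U11" for x y
      using rel[of x 3 y 1] that by (simp add: U11_iff U13_iff)
    have aut: "T (E2 x y) = E2 (T x) (T y)" for x y
      using sol(3) by (simp add: graded_product_def)
    have "\<exists>A1 A3.
        (\<forall>x y. A1 x y \<in> U11 \<and> A3 x y \<in> U13 \<and> E2 x y = A1 x y + A3 x y) \<and>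
        commutative_op A1 \<and>
        parity_skew scale U11 U13 A3 \<and>
        (\<forall>x\<in>U11. \<forall>y\<in>U11. A3 x y = - A3 y x) \<and>
        (\<forall>x\<in>U13. \<forall>y\<in>U13. A3 x y = - A3 y x) \<and>
        (\<forall>x\<in>U13. \<forall>y\<in>U11. A3 x y = scale 3 (A3 y x))"
      by (rule exI[of _ ?A1], rule exI[of _ ?A3], intro conjI allI ballI)
        (rule comm skew | (rule skew11 skew13 skew31; assumption) | use components in blast)+
    moreover have "involutive_automorphism scale E2 T"
      using aut by (simp add: involutive_automorphism_iff)
    moreover have "(\<forall>x\<in>Up. \<forall>y\<in>Up. E2 x y \<in> Up) \<and>
      (\<forall>x\<in>Um. \<forall>y\<in>Um. E2 x y \<in> Up) \<and>
      (\<forall>x\<in>Um. \<forall>y\<in>Up. E2 x y \<in> Um) \<and>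
      (\<forall>x\<in>Up. \<forall>y\<in>Um. E2 x y \<in> Um)"
      by (simp add: Up_iff Um_iff aut bilinear_mapD[OF E2])
    ultimately show ?thesis
      using sol(1,2) by (elim conjE) (intro conjI allI; assumption)
  qed
  have converse: "bilinear_map scale (first_op R Q f) \<and> bilinear_map scale (third_op R Q f) \<and>
      solves_system scale L R Q (first_op R Q f) f (third_op R Q f)"
    if f: "bilinear_map scale f"
      and A: "\<forall>x y. A1 x y \<in> U11 \<and> A3 x y \<in> U13 \<and> f x y = A1 x y + A3 x y"
      and aut: "involutive_automorphism scale f T"
      and comm: "commutative_op A1" and skew: "parity_skew scale U11 U13 A3" for f A1 A3
  proof -
    have components: "f x y = A1 x y + A3 x y" "R (A1 x y) = A1 x y" "R (A3 x y) = scale 3 (A3 x y)" for x y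
      using A U11_iff U13_iff by blast+
    \<comment> \<open>The eigenspace decomposition is unique, so \<open>A3\<close> inherits its
      vanishing at zero arguments from the bilinear \<open>f\<close>.\<close>
    have A3: "A3 x y = R3_part (f x y)" for x y
      using R3_part_eqI[OF components(2,3)] by (simp add: components(1))
    have zero_arg: "A3 0 y = 0" "A3 y 0 = 0" for y
      using bilinear_mapD(3)[OF f, of 0 0 y] bilinear_mapD(4)[OF f, of y 0 0] by (simp_all add: A3 R3_part_simps)
    have "graded_product f"
    proof (rule graded_productI[OF f])
      show "f x y = A1 x y + A3 x y" "R (A1 x y) = A1 x y" "R (A3 x y) = scale 3 (A3 x y)" for x y
        by (fact components)+
      show "A1 x y = A1 y x" for x y
        using comm by (simp add: commutative_op_def)
      show "T (f x y) = f (T x) (T y)" for x y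
        using aut by (simp add: involutive_automorphism_def)
      show "scale (3 - 2 * t) (A3 x y) + scale (3 - 2 * r) (A3 y x) = 0"
        if x: "?wt r s x" and y: "?wt t u y" for r s x t u y
      proof (cases "x = 0 \<or> y = 0")
        case True
        then show ?thesis by (auto simp: zero_arg)
      next
        case False
        have "x \<in> U11 \<union> U13" "y \<in> U11 \<union> U13"
          using wtD(1,5)[OF x] wtD(1,5)[OF y] by (auto simp: U11_iff U13_iff)
        then have "scale ((-3) ^ parity U11 y) (A3 x y) = - scale ((-3) ^ parity U11 x) (A3 y x)"
          using skew unfolding parity_skew_def by blast
        then show ?thesis
          using parity[OF wtD(5,1)[OF x]] parity[OF wtD(5,1)[OF y]] False
          by (simp add: eq_neg_iff_add_eq_0)
      qed
    qed
    then show ?thesis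
      unfolding L using f bilinear_first_op bilinear_third_op graded_product_imp_solution by blast
  qed
  have bars: "\<forall>x \<in> U11p + U13p. bar R Q x = x" "\<forall>x \<in> U11m + U13m. bar R Q x = - x"
    using bar_p bar_m by blast+
  show ?thesis
    by (rule conjI[OF bij_Q], rule conjI[OF bars(1)], rule conjI[OF bars(2)], rule conjI)
      ((intro allI impI; elim conjE; (rule direct | rule converse); assumption)+)
qed

end
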